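(* For every integer $n\ge 5$ with $n\equiv 2 \pmod 3$, there exists a $2$-connected subcubic $n$-vertex graph $G$ such that $$\mathrm{minexc}(G)=\frac{n(G)+n_2(G)}{4}+1 .$$
   Context: All graphs are finite and simple. A graph is subcubic if every vertex has degree at most three. A graph is $2$-connected if it has at least three vertices and is connected and remains connected after the removal of any single vertex. $n(G)$ is the number of vertices of $G$ and $n_2(G)$ is the number of vertices of degree two in $G$. A graph is Eulerian if all its vertices have even degree (it need not be connected). A subgraph of $G$ is spanning if it contains all vertices of $G$ (possibly some as isolated vertices). For a graph $F$, let $c(F)$ be the number of its components with at least two vertices and $i(F)$ the number of its isolated vertices, and let $\mathrm{exc}(F)=2c(F)+i(F)$. For a subcubic graph $G$, $\mathrm{minexc}(G)$ is the minimum of $\mathrm{exc}(F)$ over all spanning Eulerian subgraphs $F$ of $G$. *)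

theory Defs
  imports Complex_Main "Graph_Theory.Graph_Theory"
begin

text \<open>
  A finite simple graph is an element of the locale \<^locale>\<open>graph\<close>: a finite, loop-free
  symmetric digraph without parallel arcs, in which an edge $uv$ is the pair of arcs from $u$ to $v$
  and from $v$ to $u$. Hence the degree of a vertex is its out-degree, and the components are
  the strongly connected components.
\<close>

abbreviation degree :: "('a, 'b) pre_digraph \<Rightarrow> 'a \<Rightarrow> nat" where
  "degree G v \<equiv> out_degree G v"

definition subcubic :: "('a, 'b) pre_digraph \<Rightarrow> bool" where
  "subcubic G \<longleftrightarrow> (\<forall>v\<in>verts G. degree G v \<le> 3)"

text \<open>The qualified name avoids the topological notion of the same name.\<close>

definition two_connected :: "('a, 'b) pre_digraph \<Rightarrow> bool" where
  "two_connected G \<longleftrightarrow> card (verts G) \<ge> 3 \<and> Digraph_Component.connected G \<and>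
     (\<forall>v\<in>verts G. Digraph_Component.connected (pre_digraph.del_vert G v))"

definition num_verts :: "('a, 'b) pre_digraph \<Rightarrow> nat" where
  "num_verts G = card (verts G)"

definition num_deg2_verts :: "('a, 'b) pre_digraph \<Rightarrow> nat" where
  "num_deg2_verts G = card {v \<in> verts G. degree G v = 2}"

text \<open>Connectedness is not required.\<close>

definition eulerian :: "('a, 'b) pre_digraph \<Rightarrow> bool" where
  "eulerian G \<longleftrightarrow> (\<forall>v\<in>verts G. even (degree G v))"

definition num_nontrivial_components :: "('a, 'b) pre_digraph \<Rightarrow> nat" where
  "num_nontrivial_components F = card {S \<in> pre_digraph.sccs_verts F. card S \<ge> 2}"

definition num_isolated_verts :: "('a, 'b) pre_digraph \<Rightarrow> nat" where
  "num_isolated_verts F = card {v \<in> verts F. degree F v = 0}"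

definition exc :: "('a, 'b) pre_digraph \<Rightarrow> nat" where
  "exc F = 2 * num_nontrivial_components F + num_isolated_verts F"

text \<open>
  \<^term>\<open>spanning F G\<close> only makes \<open>F\<close> a subdigraph of \<open>G\<close>; requiring \<^term>\<open>graph F\<close> forces
  it to contain both or neither of the two arcs of each edge.
\<close>

definition minexc :: "('a, 'b) pre_digraph \<Rightarrow> nat" where
  "minexc G = (LEAST k. \<exists>F. graph F \<and> spanning F G \<and> eulerian F \<and> k = exc F)"

end

theory Submission
  imports Defs
begin

text \<open>
  For \<open>n = 3m+2\<close> take a ladder with \<open>m\<close> rungs whose two rails are closed up at each end through
  an extra vertex, and subdivide every rung. The degree-two vertices are the \<open>m\<close> rung midpoints
  and the two end vertices, so the claimed value is \<open>m+2\<close>, attained by the outer cycle. For the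
  lower bound, charge each isolated degree-two vertex to itself and the others to their component,
  which contains at most two of them: if an Eulerian subgraph uses the rung \<open>i\<close>, then by parity it
  avoids both rail edges on one side of that rung, so no component can reach degree-two vertices
  on both sides of it.
\<close>

section \<open>Digraphs given by a relation\<close>

text \<open>Taking the pairs themselves as arcs rules out parallel arcs.\<close>

definition rel_graph :: "'a set \<Rightarrow> ('a \<Rightarrow> 'a \<Rightarrow> bool) \<Rightarrow> ('a, 'a \<times> 'a) pre_digraph" where
  "rel_graph V P = \<lparr>verts = V, arcs = {(u, v). u \<in> V \<and> v \<in> V \<and> P u v}, tail = fst, head = snd\<rparr>"

lemma verts_rel_graph [simp]: "verts (rel_graph V P) = V"
  by (simp add: rel_graph_def)

lemma arcs_rel_graph [simp]: "arcs (rel_graph V P) = {(u, v). u \<in> V \<and> v \<in> V \<and> P u v}"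
  by (simp add: rel_graph_def)

lemma tail_rel_graph [simp]: "tail (rel_graph V P) = fst"
  by (simp add: rel_graph_def)

lemma head_rel_graph [simp]: "head (rel_graph V P) = snd"
  by (simp add: rel_graph_def)

lemma arcs_ends_rel_graph [simp]:
  "arcs_ends (rel_graph V P) = {(u, v). u \<in> V \<and> v \<in> V \<and> P u v}"
  by (auto simp: arcs_ends_conv)

lemma wf_digraph_rel_graph [simp]: "wf_digraph (rel_graph V P)"
  by unfold_locales auto

lemma graph_rel_graph:
  assumes "finite V" "symp P" "irreflp P"
  shows "graph (rel_graph V P)"
proof
  have "arcs (rel_graph V P) \<subseteq> V \<times> V" by auto
  then show "finite (arcs (rel_graph V P))"
    using assms(1) by (meson finite_SigmaI finite_subset)
  show "symmetric (rel_graph V P)"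
    using assms(2) by (auto simp: symmetric_def sym_def symp_def)
qed (use assms in \<open>auto simp: arc_to_ends_def irreflp_def\<close>)

lemma symp_if_graph_rel_graph:
  assumes "graph (rel_graph V P)" "u \<in> V" "v \<in> V" "P u v"
  shows "P v u"
proof -
  interpret graph "rel_graph V P" by fact
  show ?thesis using graph_symmetric[of u v] assms by auto
qed

lemma del_vert_rel_graph: "pre_digraph.del_vert (rel_graph V P) k = rel_graph (V - {k}) P"
  by (auto simp: pre_digraph.del_vert_def rel_graph_def)

lemma degree_rel_graph:
  assumes "v \<in> V"
  shows "degree (rel_graph V P) v = card {w \<in> V. P v w}"
proof -
  have "out_arcs (rel_graph V P) v = Pair v ` {w \<in> V. P v w}"
    using assms by (auto simp: out_arcs_def)
  then show ?thesis
    unfolding out_degree_def by (simp add: card_image inj_on_def)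
qed

text \<open>By symmetry, walks into a single root \<open>r\<close> suffice, and the symmetric
  closure used by \<open>connected\<close> adds no reachability.\<close>

lemma connected_rel_graph:
  assumes "r \<in> V" "symp P" "\<And>v. v \<in> V \<Longrightarrow> v \<rightarrow>\<^sup>*\<^bsub>rel_graph V P\<^esub> r"
  shows "Digraph_Component.connected (rel_graph V P)"
proof -
  interpret wf_digraph "rel_graph V P" by simp
  have sym: "symmetric (rel_graph V P)"
    using assms(2) by (auto simp: symmetric_def sym_def symp_def)
  have "u \<rightarrow>\<^sup>*\<^bsub>rel_graph V P\<^esub> v" if "u \<in> V" "v \<in> V" for u v
    using that assms(3) symmetric_reachable[OF sym] reachable_trans by blast
  then show ?thesis
    using assms(1) unfolding Digraph_Component.connected_def
    by (auto simp: strongly_connected_def reachable_mk_symmetric_eq[OF sym])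
qed

text \<open>A subdigraph keeps \<open>fst\<close> and \<open>snd\<close> as its end maps, so its arc
  set determines it; quantifying over spanning subgraphs thus becomes quantifying over
  relations.\<close>

lemma spanning_rel_graphD:
  assumes "spanning F (rel_graph V P)"
  obtains E where "F = rel_graph V E" "\<And>u v. E u v \<Longrightarrow> u \<in> V \<and> v \<in> V \<and> P u v"
proof -
  have sub: "subgraph F (rel_graph V P)" and V: "verts F = V"
    using assms by (auto simp: spanning_def)
  have arcs: "arcs F \<subseteq> {(u, v). u \<in> V \<and> v \<in> V \<and> P u v}"
    and ends: "tail F = fst" "head F = snd"
    using sub by (auto simp: subgraph_def compatible_def)
  have "F = rel_graph V (\<lambda>u v. (u, v) \<in> arcs F)"
    using V arcs ends by (auto simp: rel_graph_def intro!: pre_digraph.equality)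
  then show thesis
    using arcs by (intro that[of "\<lambda>u v. (u, v) \<in> arcs F"]) auto
qed

section \<open>Ladders with subdivided rungs\<close>

text \<open>
  The outer cycle is \<open>0, \<dots>, 2m+1\<close>. For \<open>1 \<le> i \<le> m\<close> the vertex \<open>2m+1+i\<close> subdivides the chord
  (rung) joining \<open>i\<close> and \<open>2m+2-i\<close>.
\<close>

definition cyc_step :: "nat \<Rightarrow> nat \<Rightarrow> nat \<Rightarrow> bool" where
  "cyc_step m u v \<longleftrightarrow> v = Suc u \<and> v \<le> 2*m+1 \<or> u = 0 \<and> v = 2*m+1"

text \<open>Both ends of a rung lead to its midpoint: for the lower end \<open>u = 2*m+2-i\<close>
  the midpoint \<open>2*m+1+i\<close> equals \<open>4*m+3-u\<close>.\<close>

definition rung_step :: "nat \<Rightarrow> nat \<Rightarrow> nat \<Rightarrow> bool" where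
  "rung_step m u v \<longleftrightarrow>
     1 \<le> u \<and> u \<le> m \<and> v = u + (2*m+1) \<or> m+2 \<le> u \<and> u \<le> 2*m+1 \<and> u + v = 4*m+3"

definition cyc_adj :: "nat \<Rightarrow> nat \<Rightarrow> nat \<Rightarrow> bool" where
  "cyc_adj m u v \<longleftrightarrow> cyc_step m u v \<or> cyc_step m v u"

definition ladder_adj :: "nat \<Rightarrow> nat \<Rightarrow> nat \<Rightarrow> bool" where
  "ladder_adj m u v \<longleftrightarrow> cyc_adj m u v \<or> rung_step m u v \<or> rung_step m v u"

lemmas adj_defs = ladder_adj_def cyc_adj_def cyc_step_def rung_step_def

lemma symp_cyc_adj: "symp (cyc_adj m)"
  and symp_ladder_adj: "symp (ladder_adj m)"
  by (auto simp: symp_def adj_defs)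

lemma irreflp_cyc_adj: "irreflp (cyc_adj m)"
  and irreflp_ladder_adj: "irreflp (ladder_adj m)"
  by (auto simp: irreflp_def adj_defs)

definition ladder_verts :: "nat \<Rightarrow> nat set" where
  "ladder_verts m = {..<3*m+2}"

lemma in_ladder_verts [simp]: "v \<in> ladder_verts m \<longleftrightarrow> v < 3*m+2"
  by (simp add: ladder_verts_def)

lemma finite_ladder_verts [simp]: "finite (ladder_verts m)"
  by (simp add: ladder_verts_def)

lemma card_ladder_verts [simp]: "card (ladder_verts m) = 3*m+2"
  by (simp add: ladder_verts_def)

definition ladder :: "nat \<Rightarrow> (nat, nat \<times> nat) pre_digraph" where
  "ladder m = rel_graph (ladder_verts m) (ladder_adj m)"

lemma graph_ladder: "graph (ladder m)"
  unfolding ladder_def by (intro graph_rel_graph symp_ladder_adj irreflp_ladder_adj) simp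

section \<open>Two-connectedness of the ladder\<close>

text \<open>At most one vertex is missing from the cycle: descend to 0 from below \<open>k\<close>,
  otherwise climb to \<open>2*m+1\<close> and, unless \<open>k = 0\<close>, use the closing edge. A
  general \<open>P\<close> covers both the ladder and its outer cycle.\<close>

lemma cycle_reachable:
  assumes m: "m \<ge> 1" and P: "\<And>u v. cyc_adj m u v \<Longrightarrow> P u v" and x: "x \<le> 2*m+1" "x \<noteq> k"
  shows "x \<rightarrow>\<^sup>*\<^bsub>rel_graph (ladder_verts m - {k}) P\<^esub> (if k = 0 then 2*m+1 else 0)"
proof -
  let ?G = "rel_graph (ladder_verts m - {k}) P"
  interpret wf_digraph ?G by simp
  have adj: "u \<rightarrow>\<^sup>*\<^bsub>?G\<^esub> v" if "cyc_adj m u v" "u \<noteq> k" "v \<noteq> k" for u v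
  proof -
    have "u < 3*m+2" "v < 3*m+2" using that m by (auto simp: adj_defs)
    then show ?thesis using that P by (intro reachable_adjI) auto
  qed
  show ?thesis
  proof (cases "x < k")
    case True
    have "y < k \<Longrightarrow> y \<le> 2*m+1 \<Longrightarrow> y \<rightarrow>\<^sup>*\<^bsub>?G\<^esub> 0" for y
    proof (induction y)
      case (Suc y)
      have "Suc y \<rightarrow>\<^sup>*\<^bsub>?G\<^esub> y" using Suc.prems by (intro adj) (auto simp: adj_defs)
      moreover have "y \<rightarrow>\<^sup>*\<^bsub>?G\<^esub> 0" using Suc by simp
      ultimately show ?case by (rule reachable_trans)
    qed (auto intro: reachable_refl)
    then show ?thesis using True x by auto
  next
    case False
    have "x \<rightarrow>\<^sup>*\<^bsub>?G\<^esub> (2*m+1)"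
      using x(1)
    proof (induction rule: inc_induct)
      case base
      then show ?case using False x m by (intro reachable_refl) auto
    next
      case (step y)
      have "y \<rightarrow>\<^sup>*\<^bsub>?G\<^esub> Suc y"
        using step.hyps False x by (intro adj) (auto simp: adj_defs)
      then show ?case using step.IH by (rule reachable_trans)
    qed
    moreover have "(2*m+1) \<rightarrow>\<^sup>*\<^bsub>?G\<^esub> 0" if "k \<noteq> 0"
      using that False x by (intro adj) (auto simp: adj_defs)
    ultimately show ?thesis using reachable_trans[of x "2*m+1" 0] by (cases "k = 0") simp_all
  qed
qed

text \<open>A rung midpoint has two distinct neighbours on the cycle; at most one of them is
  \<open>k\<close>, and the other leads along the cycle to the root.\<close>

lemma connected_ladder_minus:
  assumes m: "m \<ge> 1"
  shows "Digraph_Component.connected (rel_graph (ladder_verts m - {k}) (ladder_adj m))"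
proof (rule connected_rel_graph)
  let ?G = "rel_graph (ladder_verts m - {k}) (ladder_adj m)"
  let ?r = "if k = 0 then 2*m+1 else 0"
  interpret wf_digraph ?G by simp
  show "?r \<in> ladder_verts m - {k}" using m by auto
  show "symp (ladder_adj m)" by (rule symp_ladder_adj)
  have cyc: "x \<rightarrow>\<^sup>*\<^bsub>?G\<^esub> ?r" if "x \<le> 2*m+1" "x \<noteq> k" for x
    using m that by (intro cycle_reachable) (auto simp: ladder_adj_def)
  show "v \<rightarrow>\<^sup>*\<^bsub>?G\<^esub> ?r" if v: "v \<in> ladder_verts m - {k}" for v
  proof (cases "v \<le> 2*m+1")
    case True
    then show ?thesis using v by (intro cyc) auto
  next
    case False
    define i where "i = v - (2*m+1)"
    have i: "v = i + (2*m+1)" "1 \<le> i" "i \<le> m" using v False by (auto simp: i_def)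
    have "\<exists>w. w \<le> 2*m+1 \<and> w \<noteq> k \<and> ladder_adj m v w"
    proof (cases "i = k")
      case True
      then show ?thesis using i by (intro exI[of _ "2*m+2-i"]) (auto simp: adj_defs)
    next
      case neq: False
      then show ?thesis using i by (intro exI[of _ i]) (auto simp: adj_defs)
    qed
    then obtain w where w: "w \<le> 2*m+1" "w \<noteq> k" "ladder_adj m v w" by blast
    then have "v \<rightarrow>\<^sup>*\<^bsub>?G\<^esub> w" using v by (intro reachable_adjI) auto
    then show ?thesis using cyc[OF w(1,2)] by (rule reachable_trans)
  qed
qed

lemma two_connected_ladder:
  assumes "m \<ge> 1"
  shows "two_connected (ladder m)"
proof -
  \<comment> \<open>\<open>3*m+2\<close> is not a vertex, so deleting it gives the connectedness of
    the whole ladder.\<close>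
  have "ladder_verts m - {3*m+2} = ladder_verts m" by auto
  then have "Digraph_Component.connected (ladder m)"
    using connected_ladder_minus[OF assms, of "3*m+2"] by (simp add: ladder_def)
  then show ?thesis
    using assms connected_ladder_minus[OF assms]
    by (simp add: two_connected_def ladder_def del_vert_rel_graph)
qed

section \<open>Neighbourhoods and degrees\<close>

lemma nbrs_end:
  assumes "m \<ge> 1"
  shows "{w. ladder_adj m 0 w} = {1, 2*m+1}" "{w. ladder_adj m (m+1) w} = {m, m+2}"
  using assms by (auto simp: adj_defs)

lemma nbrs_top:
  assumes "1 \<le> i" "i \<le> m"
  shows "{w. ladder_adj m i w} = {i-1, i+1, i+(2*m+1)}"
  using assms by (auto simp: adj_defs)

text \<open>Reflection of the outer cycle that swaps the rails and fixes the ends 0 and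
  \<open>m+1\<close>; 0 is set apart because \<open>2*m+2\<close> would overshoot the cycle.\<close>

definition mirror :: "nat \<Rightarrow> nat \<Rightarrow> nat" where
  "mirror m i = (if i = 0 then 0 else 2*m+2-i)"

lemma nbrs_bot:
  assumes "1 \<le> i" "i \<le> m"
  shows "{w. ladder_adj m (mirror m i) w} = {mirror m (i-1), mirror m (i+1), i+(2*m+1)}"
proof -
  \<comment> \<open>Writing \<open>m = i + d\<close> removes truncated subtraction; only
    \<open>i = 1\<close> is special, its outer neighbour wrapping round to 0.\<close>
  obtain d where d: "m = i + d" using assms(2) le_Suc_ex by blast
  have b: "mirror m i = i + 2*d + 2" "mirror m (i+1) = i+2*d+1"  "mirror m (i-1) = (if i = 1 then 0 else i+2*d+3)"
     using assms unfolding mirror_def d by auto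
  show ?thesis unfolding b unfolding d using assms(1) by (auto simp: adj_defs)
qed

lemma nbrs_rung:
  assumes "1 \<le> i" "i \<le> m"
  shows "{w. ladder_adj m (i+(2*m+1)) w} = {i, mirror m i}"
proof -
  obtain d where d: "m = i + d" using assms(2) le_Suc_ex by blast
  have b: "mirror m i = i + 2*d + 2"
     using assms unfolding mirror_def d by auto
  show ?thesis unfolding b unfolding d using assms(1) by (auto simp: adj_defs)
qed

lemma ladder_vertex_cases:
  assumes "v < 3*m+2"
  obtains (zero) "v = 0" | (last) "v = m+1" | (top) "1 \<le> v" "v \<le> m"
  | (bot) i where "1 \<le> i" "i \<le> m" "v = mirror m i"
  | (rung) i where "1 \<le> i" "i \<le> m" "v = i+(2*m+1)"
proof -
  consider "v = 0" | "v = m+1" | "1 \<le> v" "v \<le> m" | "m+2 \<le> v" "v \<le> 2*m+1" | "2*m+2 \<le> v"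
    by linarith
  then show thesis
  proof cases
    case 4
    then show ?thesis using bot[of "2*m+2-v"] by (auto simp: mirror_def)
  next
    case 5
    then show ?thesis using rung[of "v-(2*m+1)"] assms by auto
  qed (use that in auto)
qed

text \<open>For \<open>m \<ge> 1\<close> these are the vertices of degree two, see
  \<open>degree_ladder\<close>. The ends 0 and \<open>m+1\<close> act as degenerate rungs beside the
  true rung midpoints.\<close>

definition rung_verts :: "nat \<Rightarrow> nat set" where
  "rung_verts m = {0, m+1} \<union> {2*m+2..<3*m+2}"

lemma card_rung_verts: "card (rung_verts m) = m + 2"
proof -
  have "card ({0, m+1} \<union> {2*m+2..<3*m+2}) = card {0, m+1} + card {2*m+2..<3*m+2}"
    by (intro card_Un_disjoint) auto
  then show ?thesis by (simp add: rung_verts_def)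
qed

lemma degree_ladder:
  assumes m: "m \<ge> 1" and v: "v < 3*m+2"
  shows "degree (ladder m) v = (if v \<in> rung_verts m then 2 else 3)"
proof -
  have "{w \<in> ladder_verts m. ladder_adj m v w} = {w. ladder_adj m v w}"
    using v by (auto simp: adj_defs)
  then have "degree (ladder m) v = card {w. ladder_adj m v w}"
    using v by (simp add: ladder_def degree_rel_graph)
  also have "\<dots> = (if v \<in> rung_verts m then 2 else 3)"
    using v m
  proof (cases rule: ladder_vertex_cases)
    case zero
    then show ?thesis using m by (simp add: nbrs_end rung_verts_def)
  next
    case last
    then show ?thesis using nbrs_end[OF m] by (simp add: rung_verts_def)
  next
    case top
    then show ?thesis by (auto simp: nbrs_top rung_verts_def card_insert_if)
  next
    case (bot i)
    then show ?thesis using nbrs_bot[OF bot(1,2)]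
      by (auto simp: rung_verts_def mirror_def card_insert_if)
  next
    case (rung i)
    then show ?thesis using nbrs_rung[OF rung(1,2)] by (auto simp: rung_verts_def mirror_def)
  qed
  finally show ?thesis .
qed

lemma subcubic_ladder: "m \<ge> 1 \<Longrightarrow> subcubic (ladder m)"
  using degree_ladder[of m] by (auto simp: subcubic_def ladder_def)

lemma num_deg2_verts_ladder:
  assumes "m \<ge> 1"
  shows "num_deg2_verts (ladder m) = m + 2"
proof -
  have "{v \<in> verts (ladder m). degree (ladder m) v = 2} = rung_verts m"
    using degree_ladder[OF assms] by (auto simp: ladder_def rung_verts_def split: if_splits)
  then show ?thesis by (simp add: num_deg2_verts_def card_rung_verts)
qed

section \<open>The outer cycle as an Eulerian subgraph\<close>

text \<open>The cycle contributes 2 and the isolated midpoints contribute \<open>m\<close>. An upper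
  bound is enough, because \<open>exc_eulerian_subgraph_ladder\<close> supplies the reverse
  inequality.\<close>

lemma eulerian_outer_cycle:
  assumes m: "m \<ge> 1"
  shows "\<exists>F. graph F \<and> spanning F (ladder m) \<and> eulerian F \<and> exc F \<le> m + 2"
proof -
  let ?F = "rel_graph (ladder_verts m) (cyc_adj m)"
  interpret graph ?F
    by (intro graph_rel_graph symp_cyc_adj irreflp_cyc_adj) simp
  have "spanning ?F (ladder m)"
    by (auto simp: spanning_def subgraph_def compatible_def ladder_def ladder_adj_def)
  moreover have deg: "degree ?F v = (if v \<le> 2*m+1 then 2 else 0)" if "v < 3*m+2" for v
  proof -
    have "{w \<in> ladder_verts m. cyc_adj m v w} =
      (if v = 0 then {1, 2*m+1} else if v = 2*m+1 then {2*m, 0}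
       else if v \<le> 2*m+1 then {v-1, v+1} else {})"
      using m by (auto simp: adj_defs)
    then show ?thesis using that m by (simp add: degree_rel_graph)
  qed
  have "eulerian ?F" using deg by (auto simp: eulerian_def)
  have "{v \<in> verts ?F. degree ?F v = 0} = {2*m+2..<3*m+2}"
    using deg by (auto simp: not_less_eq_eq split: if_splits)
  then have iso: "num_isolated_verts ?F = m" by (simp add: num_isolated_verts_def)
  \<comment> \<open>A vertex off the cycle is alone in its component, and every cycle vertex shares
    the component of 0.\<close>
  have "S = scc_of 0" if S: "S \<in> sccs_verts" "card S \<ge> 2" for S
  proof -
    obtain u where u: "u \<in> verts ?F" "S = scc_of u"
      using S(1) unfolding sccs_verts_conv_scc_of by blast
    have "u \<le> 2*m+1"
    proof (rule ccontr)
      assume "\<not> u \<le> 2*m+1"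
      then have no: "\<not> cyc_adj m u w" for w by (auto simp: adj_defs)
      have "v = u" if "u \<rightarrow>\<^sup>*\<^bsub>?F\<^esub> v" for v
        using that no by (cases rule: converse_reachable_cases) auto
      then have "S \<subseteq> {u}" using u by (auto simp: scc_of_def)
      then have "card S \<le> 1" using card_mono[of "{u}" S] by simp
      then show False using S(2) by simp
    qed
    moreover have "ladder_verts m - {3*m+2} = ladder_verts m" by auto
    ultimately have "u \<rightarrow>\<^sup>*\<^bsub>?F\<^esub> 0"
      using cycle_reachable[OF m, of "cyc_adj m" u "3*m+2"] by auto
    moreover from this have "0 \<rightarrow>\<^sup>*\<^bsub>?F\<^esub> u" by (rule symmetric_reachable')
    ultimately show ?thesis
      unfolding u scc_of_def by (intro Collect_cong) (blast intro: reachable_trans)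
  qed
  then have "{S \<in> sccs_verts. card S \<ge> 2} \<subseteq> {scc_of 0}" by auto
  then have "num_nontrivial_components ?F \<le> card {scc_of 0}"
    unfolding num_nontrivial_components_def by (intro card_mono) auto
  then have "exc ?F \<le> m + 2" using iso by (simp add: exc_def)
  then show ?thesis using \<open>eulerian ?F\<close> \<open>spanning ?F (ladder m)\<close> graph_axioms by blast
qed

section \<open>The lower bound\<close>

lemma even_card_two:
  assumes "even (card {w. Q w})" "{w. Q w} \<subseteq> {x, y}" "x \<noteq> y"
  shows "Q x \<longleftrightarrow> Q y"
proof -
  have "{w. Q w} = (if Q x then {x} else {}) \<union> (if Q y then {y} else {})"
    using assms(2) by auto
  then show ?thesis using assms(1,3) by (auto split: if_splits)
qed

text \<open>The three truth values sum to zero modulo two; solving for \<open>z\<close> expresses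
  the use of a rung through the two rail edges at its end.\<close>

lemma even_card_three:
  assumes "even (card {w. Q w})" "{w. Q w} \<subseteq> {x, y, z}" "distinct [x, y, z]"
  shows "Q z \<longleftrightarrow> (Q x \<noteq> Q y)"
proof -
  have "{w. Q w} = (if Q x then {x} else {}) \<union> (if Q y then {y} else {}) \<union> (if Q z then {z} else {})"
    using assms(2) by auto
  then show ?thesis using assms(1,3) by (auto split: if_splits)
qed

section \<open>Parity at the rungs of an Eulerian subgraph\<close>

text \<open>An Eulerian spanning subgraph reduced to its adjacency. By \<open>sub\<close>,
  \<open>E\<close> relates only vertices of the ladder, so neighbours can be counted over all
  naturals.\<close>

locale even_ladder_subgraph =
  fixes m :: nat and E :: "nat \<Rightarrow> nat \<Rightarrow> bool"
  assumes m: "m \<ge> 1"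
    and sub: "E u v \<Longrightarrow> ladder_adj m u v"
    and sym: "E u v \<Longrightarrow> E v u"
    and even: "v < 3*m+2 \<Longrightarrow> even (card {w. E v w})"
begin

lemma nbrs_subset: "{w. ladder_adj m v w} = N \<Longrightarrow> {w. E v w} \<subseteq> N"
  using sub by auto

text \<open>The midpoint has only these two neighbours in the ladder, so even degree leaves none or
  both.\<close>

lemma rung_both:
  assumes "1 \<le> i" "i \<le> m"
  shows "E (i+(2*m+1)) i \<longleftrightarrow> E (i+(2*m+1)) (mirror m i)"
  by (rule even_card_two[OF even nbrs_subset[OF nbrs_rung[OF assms]]])
    (use assms in \<open>auto simp: mirror_def\<close>)

lemma top_parity:
  assumes "1 \<le> i" "i \<le> m"
  shows "E i (i+(2*m+1)) \<longleftrightarrow> (E i (i-1) \<noteq> E i (i+1))"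
  by (rule even_card_three[OF even nbrs_subset[OF nbrs_top[OF assms]]]) (use assms in auto)

lemma bot_parity:
  assumes "1 \<le> i" "i \<le> m"
  shows "E (mirror m i) (i+(2*m+1)) \<longleftrightarrow> (E (mirror m i) (mirror m (i-1)) \<noteq> E (mirror m i) (mirror m (i+1)))"
  by (rule even_card_three[OF even nbrs_subset[OF nbrs_bot[OF assms]]])
    (use assms in \<open>auto simp: mirror_def\<close>)

lemma sym_iff: "E u v \<longleftrightarrow> E v u"
  using sym by blast

text \<open>The two edges compared here form a cut of the ladder, which an Eulerian subgraph meets evenly.\<close>

lemma rails_agree: "i \<le> m \<Longrightarrow> E i (i+1) \<longleftrightarrow> E (mirror m i) (mirror m (i+1))"
proof (induction i)
  case 0
  have "E 0 1 \<longleftrightarrow> E 0 (2*m+1)"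
    by (rule even_card_two[OF even nbrs_subset[OF nbrs_end(1)[OF m]]]) (use m in auto)
  then show ?case by (simp add: mirror_def)
next
  case (Suc i)
  \<comment> \<open>Both ends of the rung see the same rung by \<open>rung_both\<close>, so parity
    there carries the agreement from the rail edges before it to those after it.\<close>
  then show ?case
    using top_parity[of "Suc i"] bot_parity[of "Suc i"] rung_both[of "Suc i"]
      sym_iff[of "Suc i" i] sym_iff[of "mirror m (Suc i)" "mirror m i"]
      sym_iff[of "Suc i" "Suc i+(2*m+1)"] sym_iff[of "mirror m (Suc i)" "Suc i+(2*m+1)"]
    by auto
qed

section \<open>Levels and the cuts between them\<close>

text \<open>Position along the ladder: a rung's midpoint and both its ends share one level, and the
  end vertices get 0 and \<open>m+1\<close>.\<close>

definition level :: "nat \<Rightarrow> nat" where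
  "level v = (if v \<le> m+1 then v else if v \<le> 2*m+1 then 2*m+2-v else v-(2*m+1))"

text \<open>Rung edges stay within a level and cycle edges change it by exactly one.\<close>

lemma rail_crossing:
  assumes "ladder_adj m u v" "level u \<le> i" "i < level v"
  shows "i \<le> m" "u = i \<and> v = i+1 \<or> u = mirror m i \<and> v = mirror m (i+1)"
  using assms by (auto simp: adj_defs level_def mirror_def split: if_splits)

abbreviation "F \<equiv> rel_graph (ladder_verts m) E"

text \<open>By \<open>rails_agree\<close> the missing top edge forces its mirror image to be missing
  too, which empties the whole cut between levels \<open>i\<close> and \<open>i+1\<close>.\<close>

lemma reachable_same_side:
  assumes "u \<rightarrow>\<^sup>*\<^bsub>F\<^esub> v" "\<not> E i (i+1)"
  shows "level u \<le> i \<longleftrightarrow> level v \<le> i"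
proof -
  interpret wf_digraph F by simp
  have no: False if "E x y" "level x \<le> i" "i < level y" for x y
    using rail_crossing[OF sub[OF that(1)] that(2,3)] rails_agree[of i] that(1) assms(2) by auto
  show ?thesis using assms(1)
  proof (induction rule: reachable_induct)
    case (step x y)
    then have "E x y" "E y x" using sym by auto
    then have "level x \<le> i \<longleftrightarrow> level y \<le> i"
      using no[of x y] no[of y x] by (metis not_le)
    then show ?case using step.IH by simp
  qed simp
qed

text \<open>A used midpoint means a used rung, and parity at its top end then admits exactly one of
  the two rail edges there.\<close>

lemma inner_rung_separates:
  assumes "1 \<le> j" "j \<le> m" "E (j+(2*m+1)) w"
  shows "\<not> E (j-1) j \<or> \<not> E j (j+1)"
proof -
  have "w \<in> {j, mirror m j}" using sub[OF assms(3)] nbrs_rung[OF assms(1,2)] by auto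
  then have "E j (j+(2*m+1))" using rung_both[OF assms(1,2)] assms(3) sym by auto
  then show ?thesis using top_parity[OF assms(1,2)] sym_iff[of j "j-1"] by auto
qed

text \<open>Lying strictly between two others, \<open>y\<close> is a true rung midpoint, and it is
  not isolated. The empty cut beside its rung separates it from \<open>x\<close> or from
  \<open>z\<close>.\<close>

lemma no_three_in_component:
  assumes "x \<in> rung_verts m" "y \<in> rung_verts m" "z \<in> rung_verts m"
    and lev: "level x < level y" "level y < level z"
    and "E y w" and reach: "x \<rightarrow>\<^sup>*\<^bsub>F\<^esub> y" "y \<rightarrow>\<^sup>*\<^bsub>F\<^esub> z"
  shows False
proof -
  let ?j = "level y"
  have "level z \<le> m+1" using assms(3) by (auto simp: rung_verts_def level_def)
  then have j: "1 \<le> ?j" "?j \<le> m" "y = ?j+(2*m+1)"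
    using assms(2) lev by (auto simp: rung_verts_def level_def split: if_splits)
  then have "\<not> E (?j-1) (?j-1+1) \<or> \<not> E ?j (?j+1)"
    using inner_rung_separates[of ?j w] assms(6) by auto
  then show False
    using reachable_same_side[OF reach(1), of "?j-1"] reachable_same_side[OF reach(2), of ?j]
      lev j by auto
qed

section \<open>Counting degree-two vertices by components\<close>

lemma inj_on_level: "inj_on level (rung_verts m)"
  by (auto simp: inj_on_def rung_verts_def level_def)

text \<open>Three such vertices would have distinct levels, so in one of their six orderings the
  levels increase, contradicting \<open>no_three_in_component\<close>.\<close>

lemma card_component_rung_verts:
  assumes S: "\<And>u v. u \<in> S \<Longrightarrow> v \<in> S \<Longrightarrow> u \<rightarrow>\<^sup>*\<^bsub>F\<^esub> v"
  shows "card (S \<inter> {v \<in> rung_verts m. \<exists>w. E v w}) \<le> 2" (is "card ?T \<le> 2")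
proof (rule ccontr)
  assume "\<not> card ?T \<le> 2"
  then have "3 \<le> card ?T" by simp
  then obtain T where T: "T \<subseteq> ?T" "card T = 3"
    by (rule obtain_subset_with_card_n)
  obtain x y z where xyz: "T = {x, y, z}" "x \<noteq> y" "x \<noteq> z" "y \<noteq> z"
    using T(2) unfolding card_3_iff by blast
  have *: "x \<in> ?T" "y \<in> ?T" "z \<in> ?T"
    using T(1) unfolding xyz(1) by simp_all
  have neq: "level x \<noteq> level y" "level x \<noteq> level z" "level y \<noteq> level z"
    using * xyz(2-4) by (simp_all add: inj_on_eq_iff[OF inj_on_level])
  have no: "\<not> (level a < level b \<and> level b < level c)"
    if abc: "a \<in> ?T" "b \<in> ?T" "c \<in> ?T" for a b c
  proof -
    obtain w where "E b w" using abc(2) by auto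
    moreover have "a \<rightarrow>\<^sup>*\<^bsub>F\<^esub> b" "b \<rightarrow>\<^sup>*\<^bsub>F\<^esub> c" using abc by (simp_all add: S)
    ultimately show ?thesis using no_three_in_component[of a b c w] abc by blast
  qed
  show False
    using neq no[OF *(1,2,3)] no[OF *(1,3,2)] no[OF *(2,1,3)] no[OF *(2,3,1)]
      no[OF *(3,1,2)] no[OF *(3,2,1)]
    by (meson nat_neq_iff)
qed

text \<open>Every non-isolated member of \<open>rung_verts m\<close> lies in a nontrivial component,
  whose weight 2 pays for the at most two it holds; each isolated member pays for itself.\<close>

lemma exc_ge: "graph F \<Longrightarrow> exc F \<ge> m + 2"
proof -
  assume "graph F"
  then interpret graph F .
  let ?B = "{v \<in> rung_verts m. \<exists>w. E v w}"
  let ?C = "{S \<in> sccs_verts. card S \<ge> 2}"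
  have range: "u < 3*m+2" "v < 3*m+2" if "E u v" for u v
    using sub[OF that] m by (auto simp: adj_defs)
  have fin: "finite ?C" using finite_sccs_verts by simp
  have "?B \<subseteq> (\<Union>S\<in>?C. S \<inter> ?B)"
  proof
    fix v assume v: "v \<in> ?B"
    then obtain w where w: "E v w" by auto
    have vV: "v \<in> verts F" "w \<in> verts F" using range[OF w] by auto
    have "v \<rightarrow>\<^sup>*\<^bsub>F\<^esub> w" "w \<rightarrow>\<^sup>*\<^bsub>F\<^esub> v"
      using vV w sym by (auto intro!: reachable_adjI)
    then have vw: "{v, w} \<subseteq> scc_of v" using vV by (auto simp: scc_of_def)
    have sc: "scc_of v \<in> sccs_verts" using vV by (intro scc_of_in_sccs_verts)
    have "finite (scc_of v)" using sccs_verts_subsets[OF sc] finite_subset by fastforce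
    then have "card {v, w} \<le> card (scc_of v)" using vw by (intro card_mono)
    moreover have "v \<noteq> w" using sub[OF w] irreflp_ladder_adj by (auto simp: irreflp_def)
    ultimately have "scc_of v \<in> ?C" using sc by simp
    then show "v \<in> (\<Union>S\<in>?C. S \<inter> ?B)" using v vw by blast
  qed
  moreover have "finite (\<Union>S\<in>?C. S \<inter> ?B)"
    using fin by (auto simp: rung_verts_def)
  ultimately have "card ?B \<le> card (\<Union>S\<in>?C. S \<inter> ?B)" by (intro card_mono)
  also have "\<dots> \<le> (\<Sum>S\<in>?C. card (S \<inter> ?B))" using fin by (rule card_UN_le)
  also have "\<dots> \<le> (\<Sum>S\<in>?C. 2)"
    by (intro sum_mono card_component_rung_verts) (auto simp: in_sccs_verts_conv_reachable)
  finally have B: "card ?B \<le> 2 * num_nontrivial_components F"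
    by (simp add: num_nontrivial_components_def)
  have "{v \<in> rung_verts m. \<nexists>w. E v w} \<subseteq> {v \<in> verts F. degree F v = 0}"
    by (auto simp: degree_rel_graph rung_verts_def)
  then have "card {v \<in> rung_verts m. \<nexists>w. E v w} \<le> num_isolated_verts F"
    unfolding num_isolated_verts_def by (intro card_mono) auto
  moreover have "card (?B \<union> {v \<in> rung_verts m. \<nexists>w. E v w})
      \<le> card ?B + card {v \<in> rung_verts m. \<nexists>w. E v w}"
    by (rule card_Un_le)
  moreover have "?B \<union> {v \<in> rung_verts m. \<nexists>w. E v w} = rung_verts m" by auto
  ultimately show ?thesis using B by (simp add: card_rung_verts exc_def)
qed

end

section \<open>The minimum excess and the conclusion\<close>

lemma exc_eulerian_subgraph_ladder:
  assumes m: "m \<ge> 1" and F: "graph F" "spanning F (ladder m)" "eulerian F"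
  shows "exc F \<ge> m + 2"
proof -
  obtain E where FE: "F = rel_graph (ladder_verts m) E"
    and E: "\<And>u v. E u v \<Longrightarrow> u \<in> ladder_verts m \<and> v \<in> ladder_verts m \<and> ladder_adj m u v"
    using spanning_rel_graphD F(2) unfolding ladder_def by blast
  have "even_ladder_subgraph m E"
  proof
    show "E v u" if "E u v" for u v
      using symp_if_graph_rel_graph[OF F(1)[unfolded FE]] E[OF that] that by blast
    show "even (card {w. E v w})" if "v < 3*m+2" for v
    proof -
      have "{w. E v w} = {w \<in> ladder_verts m. E v w}" using E by auto
      then show ?thesis
        using F(3) that by (simp add: FE eulerian_def degree_rel_graph)
    qed
  qed (use m E in auto)
  then show ?thesis using even_ladder_subgraph.exc_ge F(1) FE by blast
qed

lemma minexc_ladder: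
  assumes "m \<ge> 1"
  shows "minexc (ladder m) = m + 2"
  unfolding minexc_def
proof (rule Least_equality)
  show "\<exists>F. graph F \<and> spanning F (ladder m) \<and> eulerian F \<and> m + 2 = exc F"
    using eulerian_outer_cycle[OF assms] exc_eulerian_subgraph_ladder[OF assms]
    by (metis le_antisym)
qed (use exc_eulerian_subgraph_ladder[OF assms] in auto)

theorem proposition29:
  fixes n :: nat
  assumes "n \<ge> 5" and "n mod 3 = 2"
  shows "\<exists>G :: (nat, nat \<times> nat) pre_digraph.
    graph G \<and> two_connected G \<and> subcubic G \<and> num_verts G = n \<and>
    real (minexc G) = (real (num_verts G) + real (num_deg2_verts G)) / 4 + 1"
proof -
  define m where "m = n div 3"
  have m: "m \<ge> 1" and n: "n = 3*m+2"
    using assms unfolding m_def by presburger+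
  have "num_verts (ladder m) = n"
    by (simp add: num_verts_def ladder_def n)
  \<comment> \<open>With \<open>n = 3*m+2\<close> and \<open>m+2\<close> vertices of degree two, the
    right-hand side is \<open>(4*m+4)/4 + 1 = m+2\<close>.\<close>
  moreover from this have
    "real (minexc (ladder m)) = (real (num_verts (ladder m)) + real (num_deg2_verts (ladder m))) / 4 + 1"
    using n by (simp add: minexc_ladder[OF m] num_deg2_verts_ladder[OF m] field_simps)
  ultimately show ?thesis
    using graph_ladder two_connected_ladder[OF m] subcubic_ladder[OF m] by blast
qed

end
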